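(* Let $\mathcal{A}=\{a_1,\ldots,a_c\}$ be a finite alphabet of size $c\ge 2$, let $n\ge 2$, let $\boldsymbol{X}_n=(X_1,\ldots,X_n)$ be an exchangeable sequence of random variables with values in $\mathcal{A}$, and let $\mu$ denote the law of the empirical measure of $\boldsymbol{X}_n$, i.e. $\mu(\boldsymbol{p})=\mathbb{P}(\mathcal{T}_n(\boldsymbol{X}_n)=\boldsymbol{p})$ for p.m.f.s $\boldsymbol{p}$ on $\mathcal{A}$. For $1\le k\le n$, let $P_k$ be the joint p.m.f. of $(X_1,\ldots,X_k)$ and let $M_{k,\mu}$ be the mixture of i.i.d. distributions $M_{k,\mu}(\boldsymbol{z})=\sum_{\boldsymbol{p}}\mu(\boldsymbol{p})\,\boldsymbol{p}^k(\boldsymbol{z})$, $\boldsymbol{z}\in\mathcal{A}^k$. Then for all $1\le k\le n$, $$D(P_k\|M_{k,\mu})\le\frac{(c-1)k(k-1)}{2(n-1)(n-k+1)}.$$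
   Context: Exchangeable means that $(X_{\pi(1)},\ldots,X_{\pi(n)})$ has the same distribution as $(X_1,\ldots,X_n)$ for every permutation $\pi$ of $\{1,\ldots,n\}$. The type $\mathcal{T}_m(\boldsymbol{y})$ of $\boldsymbol{y}\in\mathcal{A}^m$ is the vector of empirical frequencies, whose $r$th component is $\frac1m\sum_{i=1}^m\mathbb{I}(y_i=a_r)$, $1\le r\le c$. A p.m.f. $\boldsymbol{p}$ on $\mathcal{A}$ is identified with the vector $(\boldsymbol{p}(a_1),\ldots,\boldsymbol{p}(a_c))$, and $\boldsymbol{p}^k(\boldsymbol{z})=\prod_{j=1}^k\boldsymbol{p}(z_j)$. The measure $\mu$ is supported on finitely many p.m.f.s. For p.m.f.s $P,Q$ on a finite set, $D(P\|Q)=\sum_x P(x)\log(P(x)/Q(x))$ is the relative entropy (natural logarithm, $0\log 0=0$). *)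

theory Defs
  imports "HOL-Probability.Probability" "HOL-Combinatorics.Permutations"
begin

text \<open>
  Sequences of length \<open>m\<close> are functions on \<open>{1..m}\<close>; in particular
  \<open>A\<^sup>m\<close> is the extensional function space \<open>{1..m} \<rightarrow>\<^sub>E A\<close>.
\<close>

definition exchangeable :: "'w measure \<Rightarrow> 'a set \<Rightarrow> nat \<Rightarrow> (nat \<Rightarrow> 'w \<Rightarrow> 'a) \<Rightarrow> bool" where
  "exchangeable M A n X \<longleftrightarrow>
     (\<forall>\<pi>. \<pi> permutes {1..n} \<longrightarrow>
        distr M (\<Pi>\<^sub>M i\<in>{1..n}. count_space A) (\<lambda>\<omega>. \<lambda>i\<in>{1..n}. X (\<pi> i) \<omega>) =
        distr M (\<Pi>\<^sub>M i\<in>{1..n}. count_space A) (\<lambda>\<omega>. \<lambda>i\<in>{1..n}. X i \<omega>))"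

definition empirical_type :: "nat \<Rightarrow> (nat \<Rightarrow> 'a) \<Rightarrow> 'a \<Rightarrow> real" where
  "empirical_type m y a = (1 / real m) * (\<Sum>i=1..m. of_bool (y i = a))"

text \<open>A p.m.f. on \<open>A\<close> is a \<open>p :: 'a pmf\<close> with \<open>set_pmf p \<subseteq> A\<close>, identified with its
  vector of values on \<open>A\<close>.\<close>

definition empirical_law ::
    "'w measure \<Rightarrow> 'a set \<Rightarrow> nat \<Rightarrow> (nat \<Rightarrow> 'w \<Rightarrow> 'a) \<Rightarrow> 'a pmf \<Rightarrow> real" where
  "empirical_law M A n X p =
     measure M {\<omega> \<in> space M. \<forall>a\<in>A. empirical_type n (\<lambda>i. X i \<omega>) a = pmf p a}"

definition joint_pmf :: "'w measure \<Rightarrow> (nat \<Rightarrow> 'w \<Rightarrow> 'a) \<Rightarrow> nat \<Rightarrow> (nat \<Rightarrow> 'a) \<Rightarrow> real" where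
  "joint_pmf M X k z = measure M {\<omega> \<in> space M. \<forall>j\<in>{1..k}. X j \<omega> = z j}"

text \<open>The sum runs over all p.m.f.s on \<open>A\<close>; for the finitely supported \<open>\<mu>\<close> used here it is a
  finite sum, see \<open>iid_mixture_empirical_law\<close> below.\<close>

definition iid_mixture :: "'a set \<Rightarrow> ('a pmf \<Rightarrow> real) \<Rightarrow> nat \<Rightarrow> (nat \<Rightarrow> 'a) \<Rightarrow> real" where
  "iid_mixture A \<mu> k z =
     (\<Sum>\<^sub>\<infinity>p \<in> {p. set_pmf p \<subseteq> A}. \<mu> p * (\<Prod>j=1..k. pmf p (z j)))"

text \<open>A term with \<open>P x = 0\<close> vanishes. If \<open>P x > 0 = Q x\<close> for some \<open>x\<close>, the value is \<open>\<infinity>\<close>;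
  this has to be said explicitly because \<open>ln (P x / 0) = 0\<close> in HOL.\<close>

definition rel_entropy :: "'b set \<Rightarrow> ('b \<Rightarrow> real) \<Rightarrow> ('b \<Rightarrow> real) \<Rightarrow> ereal" where
  "rel_entropy S P Q =
     (if \<exists>x\<in>S. P x \<noteq> 0 \<and> Q x = 0 then \<infinity> else ereal (\<Sum>x\<in>S. P x * ln (P x / Q x)))"

lemma finite_support_empirical_law:
  assumes "finite A"
  shows "finite {p. set_pmf p \<subseteq> A \<and> empirical_law M A n X p \<noteq> 0}"
proof (rule finite_imageD)
  let ?S = "{p. set_pmf p \<subseteq> A \<and> empirical_law M A n X p \<noteq> 0}"
  let ?V = "(\<lambda>j. (1 / real n) * real j) ` {0..n}"
  let ?f = "\<lambda>p::'a pmf. \<lambda>a\<in>A. pmf p a"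
  have val: "empirical_type n y a \<in> ?V" for y :: "nat \<Rightarrow> 'a" and a
  proof -
    have "(\<Sum>i=1..n. of_bool (y i = a) :: real) = real (card ({1..n} \<inter> {i. y i = a}))"
      by (simp add: sum.If_cases of_bool_def)
    moreover have "card ({1..n} \<inter> {i. y i = a}) \<le> n"
      using card_mono[of "{1..n}" "{1..n} \<inter> {i. y i = a}"] by simp
    ultimately show ?thesis
      by (auto simp: empirical_type_def)
  qed
  have "?f ` ?S \<subseteq> A \<rightarrow>\<^sub>E ?V"
  proof (intro subsetI, elim imageE)
    fix g p assume g: "g = ?f p" and "p \<in> ?S"
    then have "{\<omega> \<in> space M. \<forall>a\<in>A. empirical_type n (\<lambda>i. X i \<omega>) a = pmf p a} \<noteq> {}"
      unfolding empirical_law_def by (metis (mono_tags, lifting) measure_empty mem_Collect_eq)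
    then obtain \<omega> where "\<forall>a\<in>A. empirical_type n (\<lambda>i. X i \<omega>) a = pmf p a"
      by blast
    then have "\<forall>a\<in>A. pmf p a \<in> ?V" using val by metis
    then show "g \<in> A \<rightarrow>\<^sub>E ?V" unfolding g by (intro PiE_I) auto
  qed
  moreover have "finite (A \<rightarrow>\<^sub>E ?V)" using assms by (intro finite_PiE) auto
  ultimately show "finite (?f ` ?S)" by (rule finite_subset)
  show "inj_on ?f ?S"
  proof (rule inj_onI)
    fix p q assume p: "p \<in> ?S" and q: "q \<in> ?S" and eq: "?f p = ?f q"
    show "p = q"
    proof (rule pmf_eqI)
      fix a
      show "pmf p a = pmf q a"
      proof (cases "a \<in> A")
        case True then show ?thesis using fun_cong[OF eq, of a] by simp
      next
        case False
        then have "a \<notin> set_pmf p" "a \<notin> set_pmf q" using p q by auto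
        then show ?thesis by (simp add: set_pmf_iff)
      qed
    qed
  qed
qed

lemma iid_mixture_empirical_law:
  assumes "finite A"
  shows "iid_mixture A (empirical_law M A n X) k z =
    (\<Sum>p \<in> {p. set_pmf p \<subseteq> A \<and> empirical_law M A n X p \<noteq> 0}.
       empirical_law M A n X p * (\<Prod>j=1..k. pmf p (z j)))"
proof -
  have "iid_mixture A (empirical_law M A n X) k z =
    (\<Sum>\<^sub>\<infinity>p \<in> {p. set_pmf p \<subseteq> A \<and> empirical_law M A n X p \<noteq> 0}.
       empirical_law M A n X p * (\<Prod>j=1..k. pmf p (z j)))"
    unfolding iid_mixture_def by (rule infsum_cong_neutral) auto
  then show ?thesis
    by (simp only: infsum_finite[OF finite_support_empirical_law[OF assms]])
qed

end

theory Submission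
  imports Defs
begin

text \<open>
  Write \<open>w\<close> for the law of the whole sequence and \<open>T x\<close> for the type of \<open>x\<close>. Given its type, an
  exchangeable sequence is sampled without replacement from an urn, so the conditional law of
  \<open>x (k + 1)\<close> given the first \<open>k\<close> draws and the type is \<open>q (a) = #{i > k. x i = a} / (n - k)\<close>.
  By joint convexity it suffices to bound the relative entropy type by type, and by the chain rule
  this is a sum over \<open>k\<close> of expectations of \<open>ln (q / T x)\<close> at the letter drawn. There
  \<open>ln t \<le> t - 1\<close> leaves a linear expectation, which exchangeability computes from the one- and
  two-point marginals: it is at most \<open>(c - 1) k / ((n - 1) (n - k))\<close>.
\<close>

section \<open>Elementary properties of empirical types\<close>

lemma empirical_type_sum:
  assumes "n > 0"
  shows "(\<Sum>i=1..n. of_bool (x i = a)) = real n * empirical_type n x a"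
  using assms by (simp add: empirical_type_def)

lemma empirical_type_nonneg: "0 \<le> empirical_type n x a"
  by (simp add: empirical_type_def sum_nonneg)

lemma empirical_type_pos:
  assumes "i \<in> {1..n}"
  shows "0 < empirical_type n x (x i)"
proof -
  have "0 < (\<Sum>j=1..n. of_bool (x j = x i) :: real)"
    using assms by (intro sum_pos2[of _ i]) auto
  then show ?thesis using assms by (simp add: empirical_type_def)
qed

lemma empirical_type_permute:
  assumes "\<pi> permutes {1..n}"
  shows "empirical_type n (x \<circ> \<pi>) = empirical_type n x"
proof
  fix a
  show "empirical_type n (x \<circ> \<pi>) a = empirical_type n x a"
    using sum.permute[OF assms, of "\<lambda>i. of_bool (x i = a) :: real"]
    by (simp add: empirical_type_def o_def)
qed

text \<open>A letter of frequency t > 0 occurs n t times and contributes 1 / t each time, hence n in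
  total. Absent letters contribute 0, which is why only an inequality holds.\<close>

lemma sum_inverse_empirical_type_le:
  assumes "finite A" and "x \<in> {1..n} \<rightarrow>\<^sub>E A"
  shows "(\<Sum>i=1..n. 1 / empirical_type n x (x i)) \<le> real n * real (card A)"
proof (cases "n = 0")
  case False
  have "(\<Sum>i=1..n. 1 / empirical_type n x (x i))
      = (\<Sum>i=1..n. \<Sum>a\<in>A. of_bool (x i = a) / empirical_type n x a)"
  proof (rule sum.cong[OF refl])
    fix i assume "i \<in> {1..n}"
    then have "x i \<in> A" using assms(2) by auto
    have "(\<Sum>a\<in>A. of_bool (x i = a) / empirical_type n x a)
        = (\<Sum>a\<in>A. if x i = a then 1 / empirical_type n x a else 0)"
      by (intro sum.cong) auto
    also have "\<dots> = 1 / empirical_type n x (x i)"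
      using \<open>x i \<in> A\<close> assms(1) by simp
    finally show "1 / empirical_type n x (x i)
        = (\<Sum>a\<in>A. of_bool (x i = a) / empirical_type n x a)" by simp
  qed
  also have "\<dots> = (\<Sum>a\<in>A. (\<Sum>i=1..n. of_bool (x i = a)) / empirical_type n x a)"
    by (subst sum.swap) (simp only: sum_divide_distrib)
  also have "\<dots> = (\<Sum>a\<in>A. real n * empirical_type n x a / empirical_type n x a)"
    using False by (simp only: empirical_type_sum)
  also have "\<dots> \<le> (\<Sum>a\<in>A. real n)"
    by (intro sum_mono) simp
  finally show ?thesis by (simp add: mult.commute)
qed simp

section \<open>Exchangeable weights and sampling without replacement\<close>

locale exchangeable_weights =
  fixes A :: "'a set" and n :: nat and w :: "(nat \<Rightarrow> 'a) \<Rightarrow> real"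
  assumes finite_A: "finite A"
    and w_nonneg: "0 \<le> w x"
    and w_permute: "\<pi> permutes {1..n} \<Longrightarrow> x \<in> {1..n} \<rightarrow>\<^sub>E A \<Longrightarrow> w (x \<circ> \<pi>) = w x"
begin

abbreviation \<Omega> :: "(nat \<Rightarrow> 'a) set" where
  "\<Omega> \<equiv> {1..n} \<rightarrow>\<^sub>E A"

abbreviation T :: "(nat \<Rightarrow> 'a) \<Rightarrow> 'a \<Rightarrow> real" where
  "T \<equiv> empirical_type n"

text \<open>The quotient \<open>class_weight k x / class_weight 0 x\<close> is the conditional
  probability of the first \<open>k\<close> letters of \<open>x\<close> given its type, whenever the
  denominator is positive.\<close>

definition class_weight :: "nat \<Rightarrow> (nat \<Rightarrow> 'a) \<Rightarrow> real" where
  "class_weight k x = (\<Sum>y\<in>\<Omega>. w y * of_bool ((\<forall>j\<in>{1..k}. y j = x j) \<and> T y = T x))"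

lemma finite_\<Omega>: "finite \<Omega>"
  using finite_A by (intro finite_PiE) auto

lemma permute_\<Omega>:
  assumes "\<pi> permutes {1..n}" and "x \<in> \<Omega>"
  shows "x \<circ> \<pi> \<in> \<Omega>"
proof (rule PiE_I)
  show "(x \<circ> \<pi>) i \<in> A" if "i \<in> {1..n}" for i
    using permutes_in_image[OF assms(1)] that PiE_mem[OF assms(2)] by (simp del: atLeastAtMost_iff)
  show "(x \<circ> \<pi>) i = undefined" if "i \<notin> {1..n}" for i
    using permutes_not_in[OF assms(1) that] PiE_arb[OF assms(2) that] by simp
qed

text \<open>Composition with \<open>\<pi>\<close> is a bijection of \<open>\<Omega>\<close> that
  preserves \<open>w\<close>. Below, invariance of \<open>w\<close> is used only in this form:
  positions may be swapped inside an expectation.\<close>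

lemma sum_permute:
  assumes \<pi>: "\<pi> permutes {1..n}"
  shows "(\<Sum>x\<in>\<Omega>. w x * g (x \<circ> \<pi>)) = (\<Sum>x\<in>\<Omega>. w x * g x)"
proof (rule sum.reindex_bij_witness[where i = "\<lambda>x. x \<circ> inv \<pi>" and j = "\<lambda>x. x \<circ> \<pi>"])
  fix x assume x: "x \<in> \<Omega>"
  show "x \<circ> \<pi> \<circ> inv \<pi> = x" "x \<circ> inv \<pi> \<circ> \<pi> = x"
    using permutes_inv_o[OF \<pi>] by (simp_all add: o_assoc[symmetric])
  show "x \<circ> \<pi> \<in> \<Omega>" "x \<circ> inv \<pi> \<in> \<Omega>"
    using permute_\<Omega> permutes_inv[OF \<pi>] \<pi> x by auto
  show "w (x \<circ> \<pi>) * g (x \<circ> \<pi>) = w x * g (x \<circ> \<pi>)"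
    using w_permute[OF \<pi> x] by simp
qed

text \<open>The content of the urn after \<open>k\<close> draws is determined by the type and the
  first \<open>k\<close> letters, so it is constant on the classes that
  \<open>class_weight k\<close> weighs.\<close>

lemma tail_count:
  assumes "k \<le> n" and "n > 0"
  shows "(\<Sum>i=Suc k..n. of_bool (x i = a)) = real n * T x a - (\<Sum>i=1..k. of_bool (x i = a))"
proof -
  have "{1..n} = {1..k} \<union> {Suc k..n}" using assms by auto
  then have "(\<Sum>i=1..n. of_bool (x i = a) :: real)
      = (\<Sum>i=1..k. of_bool (x i = a)) + (\<Sum>i=Suc k..n. of_bool (x i = a))"
    by (simp only:) (rule sum.union_disjoint, auto)
  then show ?thesis using empirical_type_sum[OF assms(2), of x a] by simp
qed

text \<open>One draw without replacement: each of the \<open>n - k\<close> remaining positions is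
  equally likely to supply the next letter, and the number of those that carry it is constant on the
  class.\<close>

lemma class_weight_Suc:
  assumes "k < n"
  shows "real (n - k) * class_weight (Suc k) x
       = class_weight k x * (\<Sum>i=Suc k..n. of_bool (x i = x (Suc k)))"
proof -
  let ?a = "x (Suc k)"
  let ?agree = "\<lambda>y. (\<forall>j\<in>{1..k}. y j = x j) \<and> T y = T x"
  \<comment> \<open>Swapping positions \<open>k + 1\<close> and \<open>i\<close> changes neither the
    first \<open>k\<close> letters nor the type, so the next letter may be looked for at any later
    position \<open>i\<close>. Summing over \<open>i\<close> then produces the count.\<close>
  have "class_weight (Suc k) x = (\<Sum>y\<in>\<Omega>. w y * (of_bool (?agree y) * of_bool (y i = ?a)))"
    if i: "i \<in> {Suc k..n}" for i
  proof -
    let ?\<tau> = "Transposition.transpose (Suc k) i"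
    have \<tau>: "?\<tau> permutes {1..n}"
      using i assms by (intro permutes_swap_id) auto
    have fixed: "?\<tau> j = j" if "j \<in> {1..k}" for j
      using that i by (auto simp: Transposition.transpose_def)
    have "class_weight (Suc k) x
        = (\<Sum>y\<in>\<Omega>. w y * (of_bool (?agree y) * of_bool (y (Suc k) = ?a)))"
      unfolding class_weight_def
      by (intro sum.cong refl arg_cong2[where f = "(*)"])
         (use atLeastAtMostSuc_conv[of 1 k] in \<open>simp flip: of_bool_conj\<close>, blast)
    also have "\<dots> = (\<Sum>y\<in>\<Omega>. w y * (of_bool (?agree (y \<circ> ?\<tau>)) * of_bool ((y \<circ> ?\<tau>) (Suc k) = ?a)))"
      by (rule sum_permute[OF \<tau>, symmetric])
    also have "\<dots> = (\<Sum>y\<in>\<Omega>. w y * (of_bool (?agree y) * of_bool (y i = ?a)))"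
      using fixed by (simp add: empirical_type_permute[OF \<tau>] del: One_nat_def)
    finally show ?thesis .
  qed
  then have "(\<Sum>i=Suc k..n. class_weight (Suc k) x)
      = (\<Sum>i=Suc k..n. \<Sum>y\<in>\<Omega>. w y * (of_bool (?agree y) * of_bool (y i = ?a)))"
    by (intro sum.cong) auto
  also have "\<dots> = (\<Sum>y\<in>\<Omega>. w y * of_bool (?agree y) * (\<Sum>i=Suc k..n. of_bool (y i = ?a)))"
    by (subst sum.swap) (simp only: sum_distrib_left mult.assoc)
  also have "\<dots> = (\<Sum>y\<in>\<Omega>. w y * of_bool (?agree y) * (\<Sum>i=Suc k..n. of_bool (x i = ?a)))"
  proof (rule sum.cong[OF refl])
    fix y
    have "(\<Sum>i=Suc k..n. of_bool (y i = ?a) :: real) = (\<Sum>i=Suc k..n. of_bool (x i = ?a))"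
      if "?agree y"
    proof -
      have "(\<Sum>i=1..k. of_bool (y i = ?a) :: real) = (\<Sum>i=1..k. of_bool (x i = ?a))"
        using that by (intro sum.cong) auto
      then show ?thesis using assms that by (simp only: tail_count less_imp_le)
    qed
    then show "w y * of_bool (?agree y) * (\<Sum>i=Suc k..n. of_bool (y i = ?a))
        = w y * of_bool (?agree y) * (\<Sum>i=Suc k..n. of_bool (x i = ?a))"
      by (cases "?agree y") auto
  qed
  also have "\<dots> = class_weight k x * (\<Sum>i=Suc k..n. of_bool (x i = ?a))"
    by (simp only: class_weight_def sum_distrib_right)
  finally show ?thesis by simp
qed

lemma class_weight_pos:
  assumes "x \<in> \<Omega>" and "w x > 0"
  shows "0 < class_weight k x"
  unfolding class_weight_def
  using assms w_nonneg by (intro sum_pos2[OF finite_\<Omega>, of x]) auto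

section \<open>Chain rule for the divergence given the type\<close>

definition inverse_mean :: "nat \<Rightarrow> real" where
  "inverse_mean i = (\<Sum>x\<in>\<Omega>. w x * (1 / T x (x i)))"

text \<open>By exchangeability the mean is the same at every position, so it equals its average over
  positions, to which \<open>sum_inverse_empirical_type_le\<close> applies sequence by
  sequence.\<close>

lemma inverse_mean_le:
  assumes "i \<in> {1..n}"
  shows "inverse_mean i \<le> real (card A) * (\<Sum>x\<in>\<Omega>. w x)"
proof -
  have "inverse_mean j = inverse_mean i" if "j \<in> {1..n}" for j
    using sum_permute[OF permutes_swap_id[OF assms that], of "\<lambda>x. 1 / T x (x i)"]
    by (simp add: inverse_mean_def empirical_type_permute[OF permutes_swap_id[OF assms that]])
  then have "real n * inverse_mean i = (\<Sum>j=1..n. inverse_mean j)" by simp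
  also have "\<dots> = (\<Sum>x\<in>\<Omega>. w x * (\<Sum>j=1..n. 1 / T x (x j)))"
    unfolding inverse_mean_def by (subst sum.swap) (simp only: sum_distrib_left)
  also have "\<dots> \<le> (\<Sum>x\<in>\<Omega>. w x * (real n * real (card A)))"
    using w_nonneg sum_inverse_empirical_type_le[OF finite_A]
    by (intro sum_mono mult_left_mono) auto
  also have "\<dots> = real n * (real (card A) * (\<Sum>x\<in>\<Omega>. w x))"
    by (simp only: sum_distrib_right[symmetric]) (simp add: mult_ac)
  finally show ?thesis using assms by simp
qed

text \<open>A swap that fixes \<open>i\<close> shows that the mean is the same for all
  \<open>j \<noteq> i\<close>. Summed over these \<open>j\<close>, the coincidences count the other
  copies of the letter at \<open>i\<close>, and division by its frequency leaves
  \<open>n - 1 / T x (x i)\<close>.\<close>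

lemma coincidence_mean:
  assumes i: "i \<in> {1..n}" and j: "j \<in> {1..n}" and "i \<noteq> j"
  shows "(real n - 1) * (\<Sum>x\<in>\<Omega>. w x * (of_bool (x j = x i) / T x (x i)))
       = real n * (\<Sum>x\<in>\<Omega>. w x) - inverse_mean i"
proof -
  let ?c = "\<lambda>j. \<Sum>x\<in>\<Omega>. w x * (of_bool (x j = x i) / T x (x i))"
  have "?c l = ?c j" if l: "l \<in> {1..n} - {i}" for l
  proof -
    have \<tau>: "Transposition.transpose j l permutes {1..n}" using j l by (intro permutes_swap_id) auto
    have "Transposition.transpose j l i = i" using l \<open>i \<noteq> j\<close> by auto
    then show ?thesis
      using sum_permute[OF \<tau>, of "\<lambda>x. of_bool (x j = x i) / T x (x i)"]
      by (simp add: empirical_type_permute[OF \<tau>])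
  qed
  then have "(\<Sum>l\<in>{1..n} - {i}. ?c l) = (\<Sum>l\<in>{1..n} - {i}. ?c j)" by (rule sum.cong[OF refl])
  also have "\<dots> = (real n - 1) * ?c j" using i by (simp add: of_nat_diff)
  finally have "(real n - 1) * ?c j = (\<Sum>l\<in>{1..n} - {i}. ?c l)" by simp
  also have "\<dots> = (\<Sum>x\<in>\<Omega>. w x * ((\<Sum>l\<in>{1..n} - {i}. of_bool (x l = x i)) / T x (x i)))"
    by (subst sum.swap) (simp only: sum_distrib_left sum_divide_distrib)
  also have "\<dots> = (\<Sum>x\<in>\<Omega>. w x * (real n - 1 / T x (x i)))"
  proof (rule sum.cong[OF refl])
    fix x
    \<comment> \<open>Position \<open>i\<close> is itself one of the \<open>n * T x (x i)\<close>
      occurrences of its letter and is subtracted.\<close>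
    have "(\<Sum>l\<in>{1..n} - {i}. of_bool (x l = x i) :: real) = real n * T x (x i) - 1"
      using i empirical_type_sum[of n x "x i"] by (subst sum_diff1) auto
    then show "w x * ((\<Sum>l\<in>{1..n} - {i}. of_bool (x l = x i)) / T x (x i))
        = w x * (real n - 1 / T x (x i))"
      using empirical_type_pos[OF i, of x] by (simp only: diff_divide_distrib) simp
  qed
  also have "\<dots> = real n * (\<Sum>x\<in>\<Omega>. w x) - inverse_mean i"
    unfolding inverse_mean_def
    by (simp only: right_diff_distrib sum_subtractf sum_distrib_left mult.commute)
  finally show ?thesis .
qed

text \<open>The quotient is q / T at the letter drawn. Its mean is a sum over positions
  \<open>i > k\<close>, each term of which is an inverse mean or a coincidence mean.\<close>

lemma increment_bound:
  assumes "k < n" and "n \<ge> 2"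
  shows "(\<Sum>x\<in>\<Omega>. w x * ((\<Sum>i=Suc k..n. of_bool (x i = x (Suc k)))
             / (real (n - k) * T x (x (Suc k))) - 1))
       \<le> (real (card A) - 1) * real k / ((real n - 1) * (real n - real k)) * (\<Sum>x\<in>\<Omega>. w x)"
proof -
  let ?l = "Suc k" and ?W = "\<Sum>x\<in>\<Omega>. w x"
  let ?c = "\<lambda>i. \<Sum>x\<in>\<Omega>. w x * (of_bool (x i = x ?l) / T x (x ?l))"
  define S where "S = inverse_mean ?l"
  have l: "?l \<in> {1..n}" using assms by auto
  have S: "S \<le> real (card A) * ?W" unfolding S_def by (rule inverse_mean_le[OF l])
  have pos: "real n - 1 > 0" "real n - real k > 0" using assms by auto
  have c: "?c i = (real n * ?W - S) / (real n - 1)" if "i \<in> {Suc ?l..n}" for i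
    using coincidence_mean[OF l, of i] that pos by (simp add: S_def field_simps)
  \<comment> \<open>Position \<open>k + 1\<close> coincides with itself and yields \<open>S\<close>;
    the other \<open>n - k - 1\<close> positions are all alike.\<close>
  have "(\<Sum>i=?l..n. ?c i) = ?c ?l + (\<Sum>i=Suc ?l..n. ?c i)"
    using assms by (simp add: sum.atLeast_Suc_atMost)
  also have "(\<Sum>i=Suc ?l..n. ?c i) = (\<Sum>i=Suc ?l..n. (real n * ?W - S) / (real n - 1))"
    using c by (rule sum.cong[OF refl])
  also have "\<dots> = (real n - real k - 1) * ((real n * ?W - S) / (real n - 1))"
    using assms by (simp add: of_nat_diff)
  also have "?c ?l = S" by (simp add: S_def inverse_mean_def)
  finally have total: "(\<Sum>i=?l..n. ?c i)
      = S + (real n - real k - 1) * ((real n * ?W - S) / (real n - 1))" .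
  have "(\<Sum>x\<in>\<Omega>. w x * ((\<Sum>i=?l..n. of_bool (x i = x ?l)) / (real (n - k) * T x (x ?l)) - 1))
      = (\<Sum>x\<in>\<Omega>. \<Sum>i=?l..n. w x * (of_bool (x i = x ?l) / T x (x ?l)) / (real n - real k)) - ?W"
    using assms by (simp add: right_diff_distrib sum_subtractf sum_distrib_left
        sum_divide_distrib of_nat_diff mult.commute del: sum_of_bool_eq)
  also have "\<dots> = (\<Sum>i=?l..n. ?c i) / (real n - real k) - ?W"
    by (subst sum.swap) (simp add: sum_divide_distrib)
  \<comment> \<open>Over the common denominator, \<open>S\<close> and \<open>?W\<close> have
    coefficients \<open>k\<close> and \<open>- k\<close>. The value is 0 for \<open>k = 0\<close>,
    as it must be: given the type, the first draw has exactly the law \<open>T\<close>.\<close>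
  also have "\<dots> = real k * (S - ?W) / ((real n - 1) * (real n - real k))"
    unfolding total using pos by (simp add: divide_simps) (simp add: algebra_simps)
  also have "\<dots> \<le> real k * (real (card A) * ?W - ?W) / ((real n - 1) * (real n - real k))"
    using S pos by (intro divide_right_mono mult_left_mono) auto
  finally show ?thesis by (simp add: algebra_simps)
qed

text \<open>For total weight 1 and \<open>k \<le> n\<close>, this is the average over types t of the
  relative entropy of the conditional law of the first \<open>k\<close> letters with respect to t^k.
  Summing over whole sequences avoids an index set of types.\<close>

definition class_divergence :: "nat \<Rightarrow> real" where
  "class_divergence k
     = (\<Sum>x\<in>\<Omega>. w x * ln (class_weight k x / (class_weight 0 x * (\<Prod>j=1..k. T x (x j)))))"

lemma class_divergence_0: "class_divergence 0 = 0"
  by (auto simp: class_divergence_def intro!: sum.neutral)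

text \<open>One more letter multiplies the likelihood ratio by \<open>?r x\<close>, the quotient q /
  T at that letter. The bound \<open>ln t \<le> t - 1\<close> makes the increment linear, ready for
  \<open>increment_bound\<close>.\<close>

lemma class_divergence_Suc:
  assumes "k < n" and "n \<ge> 2"
  shows "class_divergence (Suc k) \<le> class_divergence k
    + (real (card A) - 1) * real k / ((real n - 1) * (real n - real k)) * (\<Sum>x\<in>\<Omega>. w x)"
proof -
  let ?l = "Suc k"
  let ?D = "\<lambda>k x. class_weight k x / (class_weight 0 x * (\<Prod>j=1..k. T x (x j)))"
  let ?r = "\<lambda>x. (\<Sum>i=?l..n. of_bool (x i = x ?l)) / (real (n - k) * T x (x ?l))"
  have "w x * ln (?D ?l x) \<le> w x * ln (?D k x) + w x * (?r x - 1)" if x: "x \<in> \<Omega>" for x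
  proof (cases "w x = 0")
    \<comment> \<open>Where \<open>w x > 0\<close>, all class weights of \<open>x\<close> and the
      frequencies of its letters are positive, so the logarithm of the product splits.\<close>
    case False
    then have wx: "w x > 0" using w_nonneg[of x] by linarith
    have Tpos: "T x (x j) > 0" if "j \<in> {1..n}" for j by (rule empirical_type_pos[OF that])
    have cpos: "class_weight j x > 0" for j by (rule class_weight_pos[OF x wx])
    have "(\<Prod>j=1..k. T x (x j)) > 0" using Tpos assms by (intro prod_pos) auto
    then have Dpos: "?D k x > 0" using cpos by simp
    have Tl: "T x (x ?l) > 0" using Tpos assms by auto
    have "0 < (\<Sum>i=?l..n. of_bool (x i = x ?l) :: real)"
      using assms by (intro sum_pos2[of _ ?l]) auto
    then have rpos: "?r x > 0" using Tl assms by simp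
    have "class_weight ?l x = class_weight k x * (\<Sum>i=?l..n. of_bool (x i = x ?l)) / real (n - k)"
      using class_weight_Suc[OF assms(1), of x] assms by (simp add: field_simps)
    then have "?D ?l x = ?D k x * ?r x" by simp
    then have "ln (?D ?l x) = ln (?D k x) + ln (?r x)"
      using ln_mult_pos[OF Dpos rpos] by simp
    also have "\<dots> \<le> ln (?D k x) + (?r x - 1)"
      using ln_le_minus_one[OF rpos] by simp
    finally show ?thesis using wx by (simp flip: distrib_left)
  qed simp
  then have "class_divergence ?l \<le> (\<Sum>x\<in>\<Omega>. w x * ln (?D k x) + w x * (?r x - 1))"
    unfolding class_divergence_def by (rule sum_mono)
  also have "\<dots> = class_divergence k + (\<Sum>x\<in>\<Omega>. w x * (?r x - 1))"
    by (simp only: sum.distrib class_divergence_def)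
  finally show ?thesis using increment_bound[OF assms] by linarith
qed

lemma class_divergence_le:
  assumes "k \<le> n" and "n \<ge> 2"
  shows "class_divergence k \<le>
    (\<Sum>j<k. (real (card A) - 1) * real j / ((real n - 1) * (real n - real j))) * (\<Sum>x\<in>\<Omega>. w x)"
  using assms
proof (induction k)
  case (Suc k)
  then show ?case
    using class_divergence_Suc[of k] by (simp add: distrib_right)
qed (simp add: class_divergence_0)

section \<open>From types to the mixture\<close>

definition prefix_weight :: "nat \<Rightarrow> (nat \<Rightarrow> 'a) \<Rightarrow> real" where
  "prefix_weight k z = (\<Sum>y\<in>\<Omega>. w y * of_bool (\<forall>j\<in>{1..k}. y j = z j))"

text \<open>The mixture of i.i.d. laws, with the sum over p.m.f.s regrouped as an average over
  sequences; \<open>iid_mixture_eq_sum\<close> makes the identification.\<close>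

definition type_mixture :: "nat \<Rightarrow> (nat \<Rightarrow> 'a) \<Rightarrow> real" where
  "type_mixture k z = (\<Sum>y\<in>\<Omega>. w y * (\<Prod>j=1..k. T y (z j)))"

lemma type_mixture_nonneg: "0 \<le> type_mixture k z"
  unfolding type_mixture_def
  using w_nonneg empirical_type_nonneg by (intro sum_nonneg mult_nonneg_nonneg prod_nonneg) auto

lemma prefix_weight_pos:
  assumes "x \<in> \<Omega>" and "w x > 0"
  shows "0 < prefix_weight k x"
  unfolding prefix_weight_def
  using assms w_nonneg by (intro sum_pos2[OF finite_\<Omega>, of x]) auto

lemma type_mixture_pos:
  assumes "x \<in> \<Omega>" and "w x > 0" and "k \<le> n"
  shows "0 < type_mixture k x"
  unfolding type_mixture_def
proof (rule sum_pos2[OF finite_\<Omega> assms(1)])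
  show "0 < w x * (\<Prod>j=1..k. T x (x j))"
    using assms empirical_type_pos[of _ n x] by (intro mult_pos_pos prod_pos) auto
  show "0 \<le> w y * (\<Prod>j=1..k. T y (x j))" for y
    using w_nonneg empirical_type_nonneg by (intro mult_nonneg_nonneg prod_nonneg) auto
qed

text \<open>Every \<open>x\<close> in \<open>\<Omega>\<close> agrees with exactly one
  \<open>z\<close>, namely its restriction to \<open>{1..k}\<close>.\<close>

lemma sum_over_prefixes:
  assumes "k \<le> n"
  shows "(\<Sum>z\<in>{1..k} \<rightarrow>\<^sub>E A. \<Sum>x\<in>\<Omega>. of_bool (\<forall>j\<in>{1..k}. x j = z j) * u x)
       = (\<Sum>x\<in>\<Omega>. u x :: real)"
proof -
  have fin: "finite ({1..k} \<rightarrow>\<^sub>E A)" using finite_A by (intro finite_PiE) auto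
  have "(\<Sum>z\<in>{1..k} \<rightarrow>\<^sub>E A. of_bool (\<forall>j\<in>{1..k}. x j = z j) * u x) = u x" if x: "x \<in> \<Omega>" for x
  proof -
    have res: "restrict x {1..k} \<in> {1..k} \<rightarrow>\<^sub>E A" using x assms by fastforce
    have "(\<Sum>z\<in>{1..k} \<rightarrow>\<^sub>E A. of_bool (\<forall>j\<in>{1..k}. x j = z j) * u x)
        = (\<Sum>z\<in>{1..k} \<rightarrow>\<^sub>E A. if restrict x {1..k} = z then u x else 0)"
    proof (rule sum.cong[OF refl])
      fix z assume "z \<in> {1..k} \<rightarrow>\<^sub>E A"
      then have "(\<forall>j\<in>{1..k}. x j = z j) \<longleftrightarrow> restrict x {1..k} = z"
        by (auto simp: fun_eq_iff PiE_def extensional_def restrict_def)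
      then show "of_bool (\<forall>j\<in>{1..k}. x j = z j) * u x
          = (if restrict x {1..k} = z then u x else 0)"
        by auto
    qed
    then show ?thesis using res fin by simp
  qed
  then show ?thesis by (subst sum.swap) (rule sum.cong[OF refl])
qed

lemma prefix_cong:
  assumes "\<forall>j\<in>{1..k}. x j = z j"
  shows "prefix_weight k x = prefix_weight k z" and "type_mixture k x = type_mixture k z"
proof -
  show "prefix_weight k x = prefix_weight k z"
    unfolding prefix_weight_def using assms
    by (intro sum.cong arg_cong2[where f = "(*)"]) auto
  have "(\<Prod>j=1..k. T y (x j)) = (\<Prod>j=1..k. T y (z j))" for y
    using assms by (intro prod.cong) auto
  then show "type_mixture k x = type_mixture k z"
    unfolding type_mixture_def by (simp only:)
qed

text \<open>This moves the relative entropy from prefixes to whole sequences, where it can be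
  compared with \<open>class_divergence\<close> term by term.\<close>

lemma sum_prefix_weight:
  assumes "k \<le> n" and h: "\<And>x z. (\<forall>j\<in>{1..k}. x j = z j) \<Longrightarrow> h x = h z"
  shows "(\<Sum>z\<in>{1..k} \<rightarrow>\<^sub>E A. prefix_weight k z * h z) = (\<Sum>x\<in>\<Omega>. w x * h x)"
proof -
  have "(\<Sum>x\<in>\<Omega>. w x * of_bool (\<forall>j\<in>{1..k}. x j = z j) * h z)
      = (\<Sum>x\<in>\<Omega>. of_bool (\<forall>j\<in>{1..k}. x j = z j) * (w x * h x))" for z
  proof (rule sum.cong[OF refl])
    fix x
    show "w x * of_bool (\<forall>j\<in>{1..k}. x j = z j) * h z
        = of_bool (\<forall>j\<in>{1..k}. x j = z j) * (w x * h x)"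
      using h[of x z] by (cases "\<forall>j\<in>{1..k}. x j = z j") (simp_all del: atLeastAtMost_iff)
  qed
  then show ?thesis
    unfolding prefix_weight_def sum_distrib_right
    by (simp only: sum_over_prefixes[OF assms(1), of "\<lambda>x. w x * h x"])
qed

text \<open>Expanding \<open>class_weight 0 x\<close> over sequences \<open>y\<close> of the type of
  \<open>x\<close> and summing over \<open>x\<close> first cancels the class weights. Equality can
  fail: t^k may charge a prefix that cannot be drawn without replacement from an urn of type
  t.\<close>

lemma type_mixture_ge:
  "(\<Sum>x\<in>\<Omega>. of_bool (\<forall>j\<in>{1..k}. x j = z j)
      * (w x * (class_weight 0 x * (\<Prod>j=1..k. T x (x j)) / class_weight k x)))
   \<le> type_mixture k z"
proof -
  \<comment> \<open>This is \<open>class_weight k\<close> of any \<open>x\<close> with prefix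
    \<open>z\<close> and the type of \<open>y\<close>; \<open>y\<close> itself need not begin with
    \<open>z\<close>.\<close>
  let ?C = "\<lambda>y. \<Sum>x\<in>\<Omega>. w x * of_bool ((\<forall>j\<in>{1..k}. x j = z j) \<and> T x = T y)"
  let ?p = "\<lambda>y. \<Prod>j=1..k. T y (z j)"
  have "(\<Sum>x\<in>\<Omega>. of_bool (\<forall>j\<in>{1..k}. x j = z j)
      * (w x * (class_weight 0 x * (\<Prod>j=1..k. T x (x j)) / class_weight k x)))
    = (\<Sum>x\<in>\<Omega>. \<Sum>y\<in>\<Omega>. w y * ?p y
      * (w x * of_bool ((\<forall>j\<in>{1..k}. x j = z j) \<and> T x = T y) / ?C y))"
  proof (rule sum.cong[OF refl])
    fix x
    show "of_bool (\<forall>j\<in>{1..k}. x j = z j)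
        * (w x * (class_weight 0 x * (\<Prod>j=1..k. T x (x j)) / class_weight k x))
      = (\<Sum>y\<in>\<Omega>. w y * ?p y
        * (w x * of_bool ((\<forall>j\<in>{1..k}. x j = z j) \<and> T x = T y) / ?C y))"
    proof (cases "\<forall>j\<in>{1..k}. x j = z j")
      case True
      have "(\<Prod>j=1..k. T x (x j)) = ?p x" using True by (intro prod.cong) auto
      moreover have "class_weight k x = ?C x"
        unfolding class_weight_def using True
        by (intro sum.cong arg_cong2[where f = "(*)"]) auto
      moreover have "class_weight 0 x = (\<Sum>y\<in>\<Omega>. w y * of_bool (T y = T x))"
        by (simp add: class_weight_def)
      ultimately have "of_bool (\<forall>j\<in>{1..k}. x j = z j)
          * (w x * (class_weight 0 x * (\<Prod>j=1..k. T x (x j)) / class_weight k x))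
        = (\<Sum>y\<in>\<Omega>. w y * of_bool (T y = T x)) * (w x * ?p x / ?C x)"
        using True by (simp del: atLeastAtMost_iff)
      also have "\<dots> = (\<Sum>y\<in>\<Omega>. w y * ?p y
          * (w x * of_bool ((\<forall>j\<in>{1..k}. x j = z j) \<and> T x = T y) / ?C y))"
        unfolding sum_distrib_right
      proof (rule sum.cong[OF refl])
        fix y
        show "w y * of_bool (T y = T x) * (w x * ?p x / ?C x)
            = w y * ?p y * (w x * of_bool ((\<forall>j\<in>{1..k}. x j = z j) \<and> T x = T y) / ?C y)"
          using True by (cases "T y = T x") (simp_all del: atLeastAtMost_iff)
      qed
      finally show ?thesis .
    next
      case False
      then have "of_bool (\<forall>j\<in>{1..k}. x j = z j) = (0::real)"
        and "of_bool ((\<forall>j\<in>{1..k}. x j = z j) \<and> T x = T y) = (0::real)" for y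
        by (simp_all del: atLeastAtMost_iff)
      then show ?thesis by (simp only:) simp
    qed
  qed
  also have "\<dots> = (\<Sum>y\<in>\<Omega>. w y * ?p y * (?C y / ?C y))"
    by (subst sum.swap) (simp only: sum_distrib_left sum_divide_distrib)
  \<comment> \<open>The quotient \<open>?C y / ?C y\<close> is 1, or 0 by the convention for
    division by 0 when the type of \<open>y\<close> gives \<open>z\<close> no weight.\<close>
  also have "\<dots> \<le> (\<Sum>y\<in>\<Omega>. w y * ?p y * 1)"
    using w_nonneg empirical_type_nonneg
    by (intro sum_mono mult_left_mono mult_nonneg_nonneg prod_nonneg) auto
  finally show ?thesis by (simp add: type_mixture_def)
qed

text \<open>This is joint convexity of relative entropy over the decomposition into types: \<open>ln t \<le> t - 1\<close> is
  applied to the quotient of the two likelihood ratios.\<close>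

lemma prefix_divergence_le:
  assumes "k \<le> n"
  shows "(\<Sum>x\<in>\<Omega>. w x * ln (prefix_weight k x / type_mixture k x)) \<le> class_divergence k"
proof -
  let ?h = "\<lambda>x. prefix_weight k x / type_mixture k x"
  \<comment> \<open>The reciprocal of the likelihood ratio given the type, so
    \<open>?h x * ?a x\<close> is the quotient of the two ratios. The first goal is that its mean is
    at most the total weight.\<close>
  let ?a = "\<lambda>x. class_weight 0 x * (\<Prod>j=1..k. T x (x j)) / class_weight k x"
  have h: "?h x = ?h z" if "\<forall>j\<in>{1..k}. x j = z j" for x z
    using prefix_cong[OF that] by simp
  have P: "0 \<le> prefix_weight k z" for z
    unfolding prefix_weight_def using w_nonneg by (intro sum_nonneg) auto
  have "(\<Sum>x\<in>\<Omega>. w x * (?h x * ?a x))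
      = (\<Sum>z\<in>{1..k} \<rightarrow>\<^sub>E A. \<Sum>x\<in>\<Omega>. of_bool (\<forall>j\<in>{1..k}. x j = z j) * (w x * (?h x * ?a x)))"
    by (rule sum_over_prefixes[OF assms, symmetric])
  also have "\<dots> = (\<Sum>z\<in>{1..k} \<rightarrow>\<^sub>E A. ?h z * (\<Sum>x\<in>\<Omega>. of_bool (\<forall>j\<in>{1..k}. x j = z j) * (w x * ?a x)))"
    unfolding sum_distrib_left
  proof (intro sum.cong refl)
    fix x z
    have "of_bool b * (u * (s * a)) = t * (of_bool b * (u * a))" if "b \<Longrightarrow> s = t"
      for b and u s t a :: real
      using that by (cases b) auto
    from this[OF h]
    show "of_bool (\<forall>j\<in>{1..k}. x j = z j) * (w x * (?h x * ?a x))
        = ?h z * (of_bool (\<forall>j\<in>{1..k}. x j = z j) * (w x * ?a x))" .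
  qed
  also have "\<dots> \<le> (\<Sum>z\<in>{1..k} \<rightarrow>\<^sub>E A. ?h z * type_mixture k z)"
    using P type_mixture_nonneg type_mixture_ge
    by (intro sum_mono mult_left_mono divide_nonneg_nonneg) auto
  \<comment> \<open>Only an inequality, because \<open>?h z\<close> is 0 by convention where the
    mixture vanishes.\<close>
  also have "\<dots> \<le> (\<Sum>z\<in>{1..k} \<rightarrow>\<^sub>E A. prefix_weight k z * 1)"
    using P by (intro sum_mono) auto
  also have "\<dots> = (\<Sum>x\<in>\<Omega>. w x * 1)"
    by (rule sum_prefix_weight[OF assms refl])
  finally have le: "(\<Sum>x\<in>\<Omega>. w x * (?h x * ?a x)) \<le> (\<Sum>x\<in>\<Omega>. w x)" by simp
  have "w x * ln (?h x) \<le> w x * ln (1 / ?a x) + (w x * (?h x * ?a x) - w x)" if x: "x \<in> \<Omega>" for x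
  proof (cases "w x = 0")
    case False
    then have wx: "w x > 0" using w_nonneg[of x] by linarith
    have "(\<Prod>j=1..k. T x (x j)) > 0"
      using empirical_type_pos[of _ n x] assms by (intro prod_pos) auto
    then have apos: "?a x > 0" using class_weight_pos[OF x wx] by simp
    have hpos: "?h x > 0"
      using prefix_weight_pos[OF x wx] type_mixture_pos[OF x wx assms] by simp
    have "ln s = ln (s * t) + ln (1 / t)" if "s > 0" "t > 0" for s t :: real
      using that by (simp add: ln_mult_pos ln_div)
    from this[OF hpos apos] have "ln (?h x) = ln (?h x * ?a x) + ln (1 / ?a x)" .
    also have "\<dots> \<le> (?h x * ?a x - 1) + ln (1 / ?a x)"
      using ln_le_minus_one[OF mult_pos_pos[OF hpos apos]] by (rule add_right_mono)
    finally have "w x * ln (?h x) \<le> w x * ((?h x * ?a x - 1) + ln (1 / ?a x))"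
      using wx by (intro mult_left_mono) auto
    then show ?thesis by (simp only: algebra_simps)
  qed simp
  then have "(\<Sum>x\<in>\<Omega>. w x * ln (?h x))
      \<le> (\<Sum>x\<in>\<Omega>. w x * ln (1 / ?a x) + (w x * (?h x * ?a x) - w x))"
    by (rule sum_mono)
  also have "\<dots> = class_divergence k + ((\<Sum>x\<in>\<Omega>. w x * (?h x * ?a x)) - (\<Sum>x\<in>\<Omega>. w x))"
    by (simp only: sum.distrib sum_subtractf) (simp add: class_divergence_def)
  finally show ?thesis using le by linarith
qed

lemma rel_entropy_prefix_le:
  assumes "k \<le> n" and "n \<ge> 2" and "card A \<ge> 1" and "(\<Sum>x\<in>\<Omega>. w x) = 1"
    and P: "\<And>z. z \<in> {1..k} \<rightarrow>\<^sub>E A \<Longrightarrow> P z = prefix_weight k z"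
    and Q: "\<And>z. z \<in> {1..k} \<rightarrow>\<^sub>E A \<Longrightarrow> Q z = type_mixture k z"
  shows "rel_entropy ({1..k} \<rightarrow>\<^sub>E A) P Q
    \<le> ereal ((real (card A) - 1) * real k * (real k - 1)
         / (2 * (real n - 1) * (real n - real k + 1)))"
proof -
  let ?h = "\<lambda>x. ln (prefix_weight k x / type_mixture k x)"
  \<comment> \<open>This rules out the infinite branch: a charged prefix extends to a sequence of
    positive weight, whose own type charges every letter of the prefix.\<close>
  have "Q z \<noteq> 0" if z: "z \<in> {1..k} \<rightarrow>\<^sub>E A" and nz: "P z \<noteq> 0" for z
  proof -
    have "prefix_weight k z \<noteq> 0" using P[OF z] nz by simp
    then obtain y where y: "y \<in> \<Omega>" "w y * of_bool (\<forall>j\<in>{1..k}. y j = z j) \<noteq> 0"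
      unfolding prefix_weight_def by (meson sum.neutral)
    then have "w y > 0" "\<forall>j\<in>{1..k}. y j = z j"
      using w_nonneg[of y] by (auto simp: less_le split: if_splits)
    then show ?thesis
      using type_mixture_pos[OF y(1) _ assms(1)] prefix_cong(2)[of k y z] Q[OF z] by simp
  qed
  then have "rel_entropy ({1..k} \<rightarrow>\<^sub>E A) P Q
      = ereal (\<Sum>z\<in>{1..k} \<rightarrow>\<^sub>E A. P z * ln (P z / Q z))"
    unfolding rel_entropy_def by auto
  also have "(\<Sum>z\<in>{1..k} \<rightarrow>\<^sub>E A. P z * ln (P z / Q z))
      = (\<Sum>z\<in>{1..k} \<rightarrow>\<^sub>E A. prefix_weight k z * ?h z)"
    using P Q by (intro sum.cong) auto
  also have "\<dots> = (\<Sum>x\<in>\<Omega>. w x * ?h x)"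
    by (rule sum_prefix_weight[OF assms(1)]) (simp only: prefix_cong)
  finally have eq: "rel_entropy ({1..k} \<rightarrow>\<^sub>E A) P Q = ereal (\<Sum>x\<in>\<Omega>. w x * ?h x)" .
  have "(\<Sum>x\<in>\<Omega>. w x * ?h x)
      \<le> (\<Sum>j<k. (real (card A) - 1) * real j / ((real n - 1) * (real n - real j)))"
    using prefix_divergence_le[OF assms(1)] class_divergence_le[OF assms(1,2)] assms(4) by simp
  \<comment> \<open>Since \<open>j \<le> k - 1\<close>, each \<open>n - j\<close> is at least
    \<open>n - k + 1\<close>; the uniform denominator gives the closed form.\<close>
  also have "\<dots> \<le> (\<Sum>j<k. (real (card A) - 1) * real j / ((real n - 1) * (real n - real k + 1)))"
    using assms(1-3)
    by (intro sum_mono divide_left_mono mult_left_mono mult_nonneg_nonneg mult_pos_pos) auto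
  also have "\<dots> = (real (card A) - 1) * (\<Sum>j<k. real j) / ((real n - 1) * (real n - real k + 1))"
    by (simp only: sum_distrib_left sum_divide_distrib)
  also have "(\<Sum>j<k. real j) = real k * (real k - 1) / 2"
    by (induction k) (auto simp: field_simps)
  finally have "(\<Sum>x\<in>\<Omega>. w x * ?h x)
      \<le> (real (card A) - 1) * (real k * (real k - 1) / 2) / ((real n - 1) * (real n - real k + 1))" .
  moreover have "p * (q * r / 2) / (s * t) = p * q * r / (2 * s * t)" for p q r s t :: real
    by simp
  ultimately show ?thesis unfolding eq by (simp only: ereal_less_eq)
qed

end

section \<open>From the probability space to weights\<close>

lemma sets_Collect_Ball_eq:
  assumes "finite I" and "\<And>i. i \<in> I \<Longrightarrow> X i \<in> measurable M (count_space A)"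
  shows "{\<omega> \<in> space M. \<forall>i\<in>I. X i \<omega> = x i} \<in> sets M"
proof (rule sets.sets_Collect_finite_All[OF _ assms(1)])
  fix i assume i: "i \<in> I"
  \<comment> \<open>The intersection with \<open>A\<close> keeps the set measurable in
    \<open>count_space A\<close> even if \<open>x i\<close> lies outside \<open>A\<close>.\<close>
  have "X i -` ({x i} \<inter> A) \<inter> space M \<in> sets M"
    using assms(2)[OF i] by (rule measurable_sets) simp
  also have "X i -` ({x i} \<inter> A) \<inter> space M = {\<omega> \<in> space M. X i \<omega> = x i}"
    using measurable_space[OF assms(2)[OF i]] by auto
  finally show "{\<omega> \<in> space M. X i \<omega> = x i} \<in> sets M" .
qed

definition sequence_pmf :: "'w measure \<Rightarrow> nat \<Rightarrow> (nat \<Rightarrow> 'w \<Rightarrow> 'a) \<Rightarrow> (nat \<Rightarrow> 'a) \<Rightarrow> real" where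
  "sequence_pmf M n X x = measure M {\<omega> \<in> space M. \<forall>i\<in>{1..n}. X i \<omega> = x i}"

text \<open>The bridge to finite sums: the total mass, the joint p.m.f. and the law of the type are
  all obtained by choosing \<open>R\<close>.\<close>

lemma measure_sequence_event:
  assumes "prob_space M" and "finite A"
    and X: "\<And>i. i \<in> {1..n} \<Longrightarrow> X i \<in> measurable M (count_space A)"
  shows "measure M {\<omega> \<in> space M. R (\<lambda>i\<in>{1..n}. X i \<omega>)}
       = (\<Sum>x\<in>{1..n} \<rightarrow>\<^sub>E A. sequence_pmf M n X x * of_bool (R x))"
proof -
  interpret prob_space M by fact
  let ?E = "\<lambda>x. {\<omega> \<in> space M. \<forall>i\<in>{1..n}. X i \<omega> = x i}"
  let ?S = "{x \<in> {1..n} \<rightarrow>\<^sub>E A. R x}"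
  have fin: "finite ({1..n} \<rightarrow>\<^sub>E A)" using assms(2) by (intro finite_PiE) auto
  have eq: "(\<lambda>i\<in>{1..n}. X i \<omega>) = x \<longleftrightarrow> (\<forall>i\<in>{1..n}. X i \<omega> = x i)"
    if "x \<in> {1..n} \<rightarrow>\<^sub>E A" for x \<omega>
    using that by (auto simp: fun_eq_iff PiE_def extensional_def restrict_def)
  have mem: "(\<lambda>i\<in>{1..n}. X i \<omega>) \<in> {1..n} \<rightarrow>\<^sub>E A" if "\<omega> \<in> space M" for \<omega>
    using measurable_space[OF X that] by auto
  have "{\<omega> \<in> space M. R (\<lambda>i\<in>{1..n}. X i \<omega>)} = (\<Union>x\<in>?S. ?E x)"
  proof (intro set_eqI iffI)
    fix \<omega> assume "\<omega> \<in> {\<omega> \<in> space M. R (\<lambda>i\<in>{1..n}. X i \<omega>)}"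
    then show "\<omega> \<in> (\<Union>x\<in>?S. ?E x)"
      using mem by (intro UN_I[of "\<lambda>i\<in>{1..n}. X i \<omega>"]) auto
  next
    fix \<omega> assume "\<omega> \<in> (\<Union>x\<in>?S. ?E x)"
    then obtain x where "x \<in> ?S" "\<omega> \<in> ?E x" by blast
    then show "\<omega> \<in> {\<omega> \<in> space M. R (\<lambda>i\<in>{1..n}. X i \<omega>)}" using eq[of x \<omega>] by auto
  qed
  also have "measure M \<dots> = (\<Sum>x\<in>?S. measure M (?E x))"
  proof (rule finite_measure_finite_Union)
    show "finite ?S" using fin by simp
    show "?E ` ?S \<subseteq> sets M" using sets_Collect_Ball_eq[where X = X and I = "{1..n}", OF _ X] by (auto simp del: atLeastAtMost_iff)
    show "disjoint_family_on ?E ?S"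
      unfolding disjoint_family_on_def
    proof (intro ballI impI)
      fix x y assume "x \<in> ?S" "y \<in> ?S" "x \<noteq> y"
      then have "\<not> (\<omega> \<in> ?E x \<and> \<omega> \<in> ?E y)" for \<omega>
        using eq[of x \<omega>] eq[of y \<omega>] by (simp only: mem_Collect_eq) metis
      then show "?E x \<inter> ?E y = {}" by blast
    qed
  qed
  also have "\<dots> = (\<Sum>x\<in>{1..n} \<rightarrow>\<^sub>E A. sequence_pmf M n X x * of_bool (R x))"
    using fin by (simp add: sequence_pmf_def sum.inter_filter of_bool_def if_distrib cong: if_cong)
  finally show ?thesis .
qed

lemma empirical_type_restrict:
  "empirical_type n (\<lambda>i\<in>{1..n}. y i) = empirical_type n y"
  by (simp add: empirical_type_def fun_eq_iff)

text \<open>The type is the law of the letter at a uniformly chosen position. This realises it as a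
  \<open>pmf\<close>, the kind of object over which the mixture is taken.\<close>

lemma pmf_empirical_type:
  assumes "n > 0"
  shows "pmf (map_pmf x (pmf_of_set {1..n})) a = empirical_type n x a"
proof -
  have "pmf (map_pmf x (pmf_of_set {1..n})) a = real (card ({1..n} \<inter> x -` {a})) / real n"
    using assms by (simp add: pmf_map measure_pmf_of_set)
  also have "real (card ({1..n} \<inter> x -` {a})) = (\<Sum>i=1..n. of_bool (x i = a))"
    by (simp add: sum.If_cases of_bool_def vimage_def)
  finally show ?thesis by (simp add: empirical_type_def)
qed

lemma joint_pmf_eq_sum:
  assumes "prob_space M" and "finite A"
    and "\<And>i. i \<in> {1..n} \<Longrightarrow> X i \<in> measurable M (count_space A)" and "k \<le> n"
  shows "joint_pmf M X k z
       = (\<Sum>x\<in>{1..n} \<rightarrow>\<^sub>E A. sequence_pmf M n X x * of_bool (\<forall>j\<in>{1..k}. x j = z j))"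
proof -
  have "{\<omega> \<in> space M. \<forall>j\<in>{1..k}. X j \<omega> = z j}
      = {\<omega> \<in> space M. \<forall>j\<in>{1..k}. (\<lambda>i\<in>{1..n}. X i \<omega>) j = z j}"
    using assms(4) by auto
  then show ?thesis
    unfolding joint_pmf_def
    by (simp only:) (rule measure_sequence_event[where n = n and X = X, OF assms(1-3)])
qed

lemma empirical_law_eq_sum:
  assumes "prob_space M" and "finite A"
    and "\<And>i. i \<in> {1..n} \<Longrightarrow> X i \<in> measurable M (count_space A)"
  shows "empirical_law M A n X p
       = (\<Sum>x\<in>{1..n} \<rightarrow>\<^sub>E A. sequence_pmf M n X x
            * of_bool (\<forall>a\<in>A. empirical_type n x a = pmf p a))"
  using measure_sequence_event[where n = n and X = X, OF assms,
      where R = "\<lambda>x. \<forall>a\<in>A. empirical_type n x a = pmf p a"]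
  by (simp add: empirical_law_def empirical_type_restrict del: One_nat_def)

text \<open>After exchanging the sums over p.m.f.s and sequences, exactly one p.m.f. in the support
  matches a given sequence of positive weight: its type.\<close>

lemma iid_mixture_eq_sum:
  assumes "prob_space M" and "finite A"
    and X: "\<And>i. i \<in> {1..n} \<Longrightarrow> X i \<in> measurable M (count_space A)"
    and "n > 0" and z: "z \<in> {1..k} \<rightarrow>\<^sub>E A"
  shows "iid_mixture A (empirical_law M A n X) k z
       = (\<Sum>x\<in>{1..n} \<rightarrow>\<^sub>E A. sequence_pmf M n X x * (\<Prod>j=1..k. empirical_type n x (z j)))"
proof -
  let ?w = "sequence_pmf M n X" and ?\<Omega> = "{1..n} \<rightarrow>\<^sub>E A"
  let ?S = "{p. set_pmf p \<subseteq> A \<and> empirical_law M A n X p \<noteq> 0}"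
  let ?of = "\<lambda>x p. of_bool (\<forall>a\<in>A. empirical_type n x a = pmf p a) :: real"
  have fin: "finite ?S" by (rule finite_support_empirical_law[OF assms(2)])
  have law: "empirical_law M A n X p = (\<Sum>x\<in>?\<Omega>. ?w x * ?of x p)" for p
    using assms(1,2) X by (rule empirical_law_eq_sum)
  have "iid_mixture A (empirical_law M A n X) k z
      = (\<Sum>p\<in>?S. \<Sum>x\<in>?\<Omega>. ?w x * ?of x p * (\<Prod>j=1..k. pmf p (z j)))"
    unfolding iid_mixture_empirical_law[OF assms(2)]
    by (intro sum.cong refl)
       (simp only: law sum_distrib_right)
  also have "\<dots> = (\<Sum>x\<in>?\<Omega>. \<Sum>p\<in>?S. ?w x * ?of x p * (\<Prod>j=1..k. pmf p (z j)))"
    by (rule sum.swap)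
  also have "\<dots> = (\<Sum>x\<in>?\<Omega>. ?w x * (\<Prod>j=1..k. empirical_type n x (z j)))"
  proof (rule sum.cong[OF refl])
    fix x assume x: "x \<in> ?\<Omega>"
    let ?g = "?w x * (\<Prod>j=1..k. empirical_type n x (z j))"
    show "(\<Sum>p\<in>?S. ?w x * ?of x p * (\<Prod>j=1..k. pmf p (z j))) = ?g"
    proof (cases "?w x = 0")
      \<comment> \<open>Positive weight of \<open>x\<close> puts its type \<open>q\<close> into the
        support \<open>?S\<close>.\<close>
      case False
      then have wx: "?w x > 0" by (simp add: sequence_pmf_def less_le)
      define q where "q = map_pmf x (pmf_of_set {1..n})"
      have q: "pmf q a = empirical_type n x a" for a
        unfolding q_def by (rule pmf_empirical_type[OF assms(4)])
      have qA: "set_pmf q \<subseteq> A" using x assms(4) by (auto simp: q_def)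
      have "0 < empirical_law M A n X q"
        unfolding law
      proof (rule sum_pos2[OF _ x])
        show "finite ?\<Omega>" using assms(2) by (intro finite_PiE) auto
        show "0 < ?w x * ?of x q" using wx q by simp
        show "0 \<le> ?w y * ?of y q" for y by (simp add: sequence_pmf_def)
      qed
      then have qS: "q \<in> ?S" using qA by simp
      have uniq: "p = q" if "p \<in> ?S" "\<forall>a\<in>A. empirical_type n x a = pmf p a" for p
      proof (rule pmf_eqI)
        fix a
        show "pmf p a = pmf q a"
        proof (cases "a \<in> A")
          case False
          then have "a \<notin> set_pmf p" "a \<notin> set_pmf q" using that qA by auto
          then show ?thesis by (simp add: set_pmf_iff)
        qed (use that q in simp)
      qed
      have "(\<Sum>p\<in>?S. ?w x * ?of x p * (\<Prod>j=1..k. pmf p (z j)))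
          = (\<Sum>p\<in>?S. if q = p then ?g else 0)"
      proof (rule sum.cong[OF refl])
        fix p assume "p \<in> ?S"
        then show "?w x * ?of x p * (\<Prod>j=1..k. pmf p (z j)) = (if q = p then ?g else 0)"
          using uniq[of p] q by auto
      qed
      then show ?thesis using fin qS by simp
    qed simp
  qed
  finally show ?thesis .
qed

text \<open>Exchangeability is evaluated at the singleton \<open>{x}\<close>. It is applied to
  \<open>inv \<pi>\<close>, since substituting \<open>\<pi> i\<close> for \<open>i\<close> moves the
  permutation from the indices of \<open>X\<close> to \<open>x\<close>.\<close>

lemma sequence_pmf_permute:
  assumes X: "\<And>i. i \<in> {1..n} \<Longrightarrow> X i \<in> measurable M (count_space A)"
    and "exchangeable M A n X" and \<pi>: "\<pi> permutes {1..n}" and x: "x \<in> {1..n} \<rightarrow>\<^sub>E A"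
  shows "sequence_pmf M n X (x \<circ> \<pi>) = sequence_pmf M n X x"
proof -
  let ?N = "\<Pi>\<^sub>M i\<in>{1..n}. count_space A"
  let ?Y = "\<lambda>\<sigma> \<omega>. \<lambda>i\<in>{1..n}. X (\<sigma> i) \<omega>"
  have meas: "?Y \<sigma> \<in> measurable M ?N" if "\<sigma> permutes {1..n}" for \<sigma>
    using X permutes_in_image[OF that] by (intro measurable_restrict) blast
  have "{x} = Pi\<^sub>E {1..n} (\<lambda>i. {x i})"
    using PiE_singleton[of x "{1..n}"] x by (simp only: PiE_iff)
  also have "\<dots> \<in> sets ?N"
    using x by (intro sets_PiM_I_finite) auto
  finally have sx: "{x} \<in> sets ?N" .
  have dist: "measure (distr M ?N (?Y \<sigma>)) {x} = measure M {\<omega> \<in> space M. \<forall>i\<in>{1..n}. X (\<sigma> i) \<omega> = x i}"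
    if "\<sigma> permutes {1..n}" for \<sigma>
  proof -
    have "?Y \<sigma> -` {x} \<inter> space M = {\<omega> \<in> space M. \<forall>i\<in>{1..n}. X (\<sigma> i) \<omega> = x i}"
      using x by (auto simp: fun_eq_iff PiE_def extensional_def restrict_def)
    then show ?thesis by (simp only: measure_distr[OF meas[OF that] sx])
  qed
  have inv: "inv \<pi> permutes {1..n}" by (rule permutes_inv[OF \<pi>])
  have "{\<omega> \<in> space M. \<forall>i\<in>{1..n}. X (inv \<pi> i) \<omega> = x i}
      = {\<omega> \<in> space M. \<forall>i\<in>{1..n}. X i \<omega> = (x \<circ> \<pi>) i}"
  proof -
    have "(\<forall>i\<in>{1..n}. X (inv \<pi> i) \<omega> = x i) \<longleftrightarrow> (\<forall>i\<in>{1..n}. X i \<omega> = x (\<pi> i))" for \<omega>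
      using permutes_in_image[OF \<pi>] permutes_in_image[OF inv] permutes_inverses[OF \<pi>] by metis
    then show ?thesis by simp
  qed
  moreover have "distr M ?N (?Y (inv \<pi>)) = distr M ?N (?Y id)"
    using assms(2) inv by (simp add: exchangeable_def)
  ultimately show ?thesis
    using dist[OF inv] dist[OF permutes_id] by (simp add: sequence_pmf_def)
qed

theorem corollary1p4:
  fixes M :: "'w measure" and A :: "'a set" and X :: "nat \<Rightarrow> 'w \<Rightarrow> 'a" and c n k :: nat
  assumes "prob_space M"
    and "finite A" and "card A = c" and "c \<ge> 2"
    and "n \<ge> 2"
    and "\<And>i. i \<in> {1..n} \<Longrightarrow> X i \<in> measurable M (count_space A)"
    and "exchangeable M A n X"
    and "1 \<le> k" and "k \<le> n"
  shows "rel_entropy ({1..k} \<rightarrow>\<^sub>E A) (joint_pmf M X k)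
           (iid_mixture A (empirical_law M A n X) k)
         \<le> ereal ((real c - 1) * real k * (real k - 1)
                    / (2 * (real n - 1) * (real n - real k + 1)))"
proof -
  \<comment> \<open>Exchangeability of \<open>X\<close> enters here, as permutation invariance of
    the law of the whole sequence.\<close>
  interpret exchangeable_weights A n "sequence_pmf M n X"
    using assms(2) sequence_pmf_permute[where n = n and X = X, OF assms(6,7)]
    by unfold_locales (auto simp: sequence_pmf_def)
  have "(\<Sum>x\<in>{1..n} \<rightarrow>\<^sub>E A. sequence_pmf M n X x) = measure M (space M)"
    using measure_sequence_event[where n = n and X = X, OF assms(1,2,6), where R = "\<lambda>_. True"] by simp
  then have one: "(\<Sum>x\<in>{1..n} \<rightarrow>\<^sub>E A. sequence_pmf M n X x) = 1"
    using prob_space.prob_space[OF assms(1)] by simp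
  have "rel_entropy ({1..k} \<rightarrow>\<^sub>E A) (joint_pmf M X k)
           (iid_mixture A (empirical_law M A n X) k)
      \<le> ereal ((real (card A) - 1) * real k * (real k - 1)
                    / (2 * (real n - 1) * (real n - real k + 1)))"
  proof (rule rel_entropy_prefix_le[OF assms(9,5) _ one])
    show "1 \<le> card A" using assms by simp
    show "joint_pmf M X k z = prefix_weight k z" for z
      unfolding prefix_weight_def by (rule joint_pmf_eq_sum[where n = n and X = X, OF assms(1,2,6,9)])
    show "iid_mixture A (empirical_law M A n X) k z = type_mixture k z"
      if "z \<in> {1..k} \<rightarrow>\<^sub>E A" for z
      unfolding type_mixture_def using assms(5)
      by (intro iid_mixture_eq_sum[where n = n and X = X, OF assms(1,2,6) _ that]) auto
  qed
  then show ?thesis using assms(3) by simp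
qed

end
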